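(* Let $2\le k\le d$ and let $X$ be a random vector with values in $\mathbb S_+^{d-1}=\{x\in\mathbb R^d: x_i\ge 0\ \forall i,\ \|x\|_2=1\}$. Let $(I_1,\ldots,I_k)$ be a partition of $\{1,\ldots,d\}$ into non-empty sets such that $\Pr(X\in F_{I_1}\cup\cdots\cup F_{I_k})=1$. With $p_I$, $\Sigma_I$, $\mu_I$ and $\lambda_j$ as defined in the context, suppose that $$\min_{I=I_1,\ldots,I_k} p_I\lambda_1(\Sigma_I)\ \ge\ \max_{I=I_1,\ldots,I_k} p_I\lambda_2(\Sigma_I).$$ Then there exists a maximizer $(x_1,\ldots,x_k)$ of $$\max_{x_1,\ldots,x_k\in\mathbb S_+^{d-1}} E\Big(\max_{1\le i\le k}(x_i^\top X)^2\Big)$$ (that is, optimal centroids of spherical $k$-principal-components clustering) such that $x_i\in F_{I_i}$ for all $i=1,\ldots,k$. Moreover, the displayed min-max condition is satisfied whenever $E(X_1)=\cdots=E(X_d)=\mu>0$ and $$\lambda_2(\Sigma_I)\le \mu_I\qquad\text{for } I=I_1,\ldots,I_k.$$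
   Context: For $I\subset\{1,\ldots,d\}$ non-empty, the face is $F_I=\{x\in\mathbb R^d: x_i\ge 0\ \forall i,\ x_j=0\ \forall j\notin I\}$. For $I=I_1,\ldots,I_k$ put $p_I=\Pr(X\in F_I)$, assumed to be $>0$ (this is automatic when all $E(X_i)$ equal a common $\mu>0$). The submodel $X_I$ is a random vector in $\mathbb S_+^{|I|-1}$ whose law is that of the restriction of $X$ to the coordinates in $I$, conditional on $\{X\in F_I\}$. Its cross-moment matrix is $\Sigma_I=E(X_IX_I^\top)$ (of order $|I|$). When $E(X_1)=\cdots=E(X_d)=\mu>0$, put $\mu_I=\mu/p_I$; then every component of $X_I$ has mean $\mu_I$. For a symmetric matrix $M$, $\lambda_j(M)$ denotes its $j$th largest eigenvalue (counted with multiplicity), with $\lambda_j(M)=0$ when $j$ exceeds the order of $M$. Labelling convention (no loss of generality): the coordinates are ordered so that the indices in $I_i$ are smaller than those in $I_j$ for $i<j$. *)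

theory Defs
  imports "HOL-Probability.Probability" "Jordan_Normal_Form.Char_Poly"
begin

(* Reserve the infix dollar for components of elements of real ^ 'n; the vectors of
   Jordan_Normal_Form are not used. *)
no_notation vec_index (infixl "$" 100)

definition nonneg_sphere :: "(real ^ 'n) set" where
  "nonneg_sphere = {x. (\<forall>i. 0 \<le> x $ i) \<and> norm x = 1}"

definition face :: "'n set \<Rightarrow> (real ^ 'n) set" where
  "face I = {x. (\<forall>i. 0 \<le> x $ i) \<and> (\<forall>j. j \<notin> I \<longrightarrow> x $ j = 0)}"

definition face_prob :: "'a measure \<Rightarrow> ('a \<Rightarrow> real ^ 'n) \<Rightarrow> 'n set \<Rightarrow> real" where
  "face_prob M X I = \<P>(\<omega> in M. X \<omega> \<in> face I)"

(* The law of the submodel X_I.  Vectors with coordinates in I are extensional functions on I;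
   uniform_measure M A is M conditioned on the event A. *)
definition submodel_law :: "'a measure \<Rightarrow> ('a \<Rightarrow> real ^ 'n) \<Rightarrow> 'n set \<Rightarrow> ('n \<Rightarrow> real) measure" where
  "submodel_law M X I =
     distr (uniform_measure M {\<omega> \<in> space M. X \<omega> \<in> face I})
       (Pi\<^sub>M I (\<lambda>_. borel)) (\<lambda>\<omega>. restrict (vec_nth (X \<omega>)) I)"

(* Rows and columns follow the increasing enumeration of I. *)
definition cross_moment :: "'a measure \<Rightarrow> ('a \<Rightarrow> real ^ 'n::{finite, linorder}) \<Rightarrow> 'n set \<Rightarrow> real mat" where
  "cross_moment M X I =
     mat (card I) (card I)
       (\<lambda>(a, b). \<integral>z. z (sorted_list_of_set I ! a) * z (sorted_list_of_set I ! b) \<partial>submodel_law M X I)"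

(* The j-th largest eigenvalue (j counted from 1), with multiplicity.  For a symmetric real matrix
   the characteristic polynomial splits, so the list below has as many entries as the order of A. *)
definition nth_eigenvalue :: "nat \<Rightarrow> real mat \<Rightarrow> real" where
  "nth_eigenvalue j A =
     (let es = rev (sorted_list_of_multiset (proots (char_poly A)))
      in if 1 \<le> j \<and> j \<le> length es then es ! (j - 1) else 0)"

definition clustering_value :: "'a measure \<Rightarrow> ('a \<Rightarrow> real ^ 'n) \<Rightarrow> nat \<Rightarrow> (nat \<Rightarrow> real ^ 'n) \<Rightarrow> real" where
  "clustering_value M X k x = (\<integral>\<omega>. (MAX i\<in>{1..k}. (x i \<bullet> X \<omega>)\<^sup>2) \<partial>M)"

(* Optimal centroids; only the values x 1, ..., x k matter. *)
definition optimal_centroids :: "'a measure \<Rightarrow> ('a \<Rightarrow> real ^ 'n) \<Rightarrow> nat \<Rightarrow> (nat \<Rightarrow> real ^ 'n) \<Rightarrow> bool" where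
  "optimal_centroids M X k =
     is_arg_max (clustering_value M X k) (\<lambda>x. \<forall>i\<in>{1..k}. x i \<in> nonneg_sphere)"

end

theory Submission
  imports Defs
begin

text \<open>
  Let \<open>U\<close> be the span of the centroids \<open>x\<^sub>1, ..., x\<^sub>k\<close>, and let \<open>P\<close> be the orthogonal
  projection onto it. Unit vectors satisfy \<open>(x\<^sub>i \<bullet> X)\<^sup>2 \<le> \<parallel>P X\<parallel>\<^sup>2\<close>, so the clustering objective
  is at most \<open>E \<parallel>P X\<parallel>\<^sup>2 = tr (P \<Sigma>)\<close> with \<open>\<Sigma> = E (X X\<^sup>T)\<close>. As \<open>dim U \<le> k\<close>, this trace is at most the
  sum of the \<open>k\<close> largest eigenvalues of \<open>\<Sigma>\<close> (the Ky Fan principle). Thus clustering is relaxed to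
  ordinary principal component analysis, and it remains to see that the relaxation is tight.

  Almost surely \<open>X\<close> lies in one of the faces, so products of coordinates from different blocks
  vanish and \<open>\<Sigma>\<close> is block diagonal with blocks \<open>p\<^sub>I \<Sigma>\<^sub>I\<close>. The min-max condition says precisely that
  the \<open>k\<close> largest eigenvalues of \<open>\<Sigma>\<close> can be taken to be the largest eigenvalues of the \<open>k\<close> blocks.
  Their sum is attained: since \<open>X \<ge> 0\<close>, replacing a top eigenvector of a block by its vector of
  absolute values does not decrease the quadratic form, so each block has a top eigenvector in its
  face, and using these as centroids achieves the sum.

  The bound is proved without diagonalising \<open>\<Sigma>\<close> as a whole. Write \<open>a\<^sub>i\<close> for the top eigenvalue of
  the block \<open>i\<close> with unit eigenvector \<open>v\<^sub>i\<close>, and \<open>c\<close> for the maximum of the second eigenvalues. The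
  lemma \<open>second_moment_le\<close> gives \<open>E (u \<bullet> X)\<^sup>2 \<le> c \<parallel>u\<parallel>\<^sup>2 + \<Sum>\<^sub>i (a\<^sub>i - c) (u \<bullet> v\<^sub>i)\<^sup>2\<close> for every \<open>u\<close>. Summing over an
  orthonormal basis of \<open>U\<close> and using the Bessel inequality for each \<open>v\<^sub>i\<close> yields
  \<open>c k + \<Sum>\<^sub>i (a\<^sub>i - c) = \<Sum>\<^sub>i a\<^sub>i\<close> (lemma \<open>clustering_value_le\<close>).

  The eigenvalues of the statement are roots of a characteristic polynomial. They are linked to
  quadratic forms by the spectral theorem (\<open>self_adjoint_eigenbasis_on_subspace\<close>,
  \<open>principal_submatrix_eigenbasis\<close>).

  For the sufficient condition on the means, the vector of ones on a block \<open>I\<close> is a test vector: on the face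
  \<open>\<Sum>\<^sub>j X\<^sub>j \<ge> \<parallel>X\<parallel>\<^sub>2 = 1\<close>, hence \<open>(\<Sum>\<^sub>j X\<^sub>j)\<^sup>2 \<ge> \<Sum>\<^sub>j X\<^sub>j\<close>, and taking expectations shows that \<open>p\<^sub>I\<close> times
  the largest eigenvalue of \<open>\<Sigma>\<^sub>I\<close> is at least \<open>\<mu>\<close>.
\<close>

(* The dot is to mean the inner product of real inner product spaces only. *)
no_notation scalar_prod (infix "\<bullet>" 70)

section \<open>Spectral theorem for self-adjoint maps on subspaces\<close>

text \<open>
  The Rayleigh quotient attains its maximum on the compact unit sphere of \<open>S\<close>; a maximiser is an
  eigenvector, and its orthogonal complement in \<open>S\<close> is again invariant, so induction on the dimension applies.
  The last clause is one half of the Courant-Fischer characterisation: it bounds the quadratic form on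
  vectors orthogonal to the first \<open>i\<close> eigenvectors, and it comes from the maximality at each stage. It also
  implies that the eigenvalues decrease. Setting \<open>l i = 0\<close> beyond the dimension keeps this clause
  true for all \<open>i\<close>, because only \<open>y = 0\<close> remains there.
\<close>
lemma self_adjoint_eigenbasis_on_subspace:
  fixes f :: "'a::euclidean_space \<Rightarrow> 'a"
  assumes lin: "linear f" and sym: "\<And>x y. f x \<bullet> y = x \<bullet> f y"
    and "subspace S" and "f ` S \<subseteq> S"
  shows "\<exists>b l. (\<forall>i<dim S. b i \<in> S \<and> f (b i) = l i *\<^sub>R b i) \<and>
    (\<forall>i<dim S. \<forall>j<dim S. b i \<bullet> b j = (if i = j then 1 else 0)) \<and>
    (\<forall>i\<ge>dim S. l i = (0::real)) \<and>
    (\<forall>i. \<forall>y\<in>S. (\<forall>j<min i (dim S). b j \<bullet> y = 0) \<longrightarrow> f y \<bullet> y \<le> l i * (y \<bullet> y))"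
  using assms(3,4)
proof (induction "dim S" arbitrary: S)
  case 0
  then have "S \<subseteq> {0}"
    using dim_eq_0[of S] by simp
  then show ?case
    unfolding 0(1)[symmetric] by (intro exI[of _ "\<lambda>_. 0"]) auto
next
  case (Suc n)
  note sub = \<open>subspace S\<close>
  define K where "K = S \<inter> sphere 0 1"
  have "compact K"
    unfolding K_def by (simp add: sub closed_subspace closed_Int_compact)
  moreover have "K \<noteq> {}"
  proof -
    have "\<not> S \<subseteq> {0}"
      unfolding dim_eq_0[symmetric] Suc.hyps(2)[symmetric] by simp
    then obtain x where "x \<in> S" "x \<noteq> 0" by blast
    then have "x /\<^sub>R norm x \<in> K"
      by (simp add: K_def sub subspace_scale)
    then show ?thesis by blast
  qed
  moreover have "continuous_on K (\<lambda>x. f x \<bullet> x)"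
    by (intro continuous_on_inner continuous_on_id linear_continuous_on)
      (simp add: lin linear_conv_bounded_linear[symmetric])
  ultimately obtain v where vK: "v \<in> K" and max: "\<And>x. x \<in> K \<Longrightarrow> f x \<bullet> x \<le> f v \<bullet> v"
    using continuous_attains_sup[of K "\<lambda>x. f x \<bullet> x"] by blast
  from vK have v: "v \<in> S" "norm v = 1" by (auto simp: K_def)
  then have vv: "v \<bullet> v = 1" by (simp add: dot_square_norm)
  define a where "a = f v \<bullet> v"
  have rayleigh: "f y \<bullet> y \<le> a * (y \<bullet> y)" if y: "y \<in> S" for y
  proof (cases "y = 0")
    case True
    then show ?thesis by simp
  next
    case False
    have "y /\<^sub>R norm y \<in> K"
      using y False by (simp add: K_def sub subspace_scale)
    from max[OF this] have "(f y \<bullet> y) / (norm y)\<^sup>2 \<le> a"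
      by (simp add: a_def linear_cmul[OF lin] divide_inverse power2_eq_square mult_ac)
    then show ?thesis
      using False by (simp add: dot_square_norm pos_divide_le_eq)
  qed
  \<comment> \<open>Perturbing the maximiser by \<open>t y\<close> forces the linear term in \<open>t\<close> to vanish.\<close>
  have stationary: "f v \<bullet> y = 0" if y: "y \<in> S" and vy: "v \<bullet> y = 0" for y
  proof (rule ccontr)
    assume nz: "f v \<bullet> y \<noteq> 0"
    define c where "c = a * (y \<bullet> y) - f y \<bullet> y"
    have le: "2 * t * (f v \<bullet> y) \<le> t\<^sup>2 * c" for t
    proof -
      have "v + t *\<^sub>R y \<in> S"
        using v y sub by (simp add: subspace_add subspace_scale)
      note r = rayleigh[OF this]
      have e1: "f (v + t *\<^sub>R y) \<bullet> (v + t *\<^sub>R y) = a + 2 * t * (f v \<bullet> y) + t\<^sup>2 * (f y \<bullet> y)"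
      proof -
        have "f y \<bullet> v = f v \<bullet> y" by (simp only: sym[of y v] inner_commute[of y])
        then show ?thesis
          by (simp add: linear_add[OF lin] linear_cmul[OF lin] inner_add a_def power2_eq_square
              algebra_simps)
      qed
      have e2: "(v + t *\<^sub>R y) \<bullet> (v + t *\<^sub>R y) = 1 + t\<^sup>2 * (y \<bullet> y)"
        using vv vy by (simp add: inner_add inner_commute[of y v] power2_eq_square)
      from r[unfolded e1 e2] show ?thesis by (simp add: c_def algebra_simps)
    qed
    have c0: "0 \<le> c" using rayleigh[OF y] by (simp add: c_def)
    \<comment> \<open>Near the best \<open>t\<close>; the denominator \<open>c + 1\<close> instead of \<open>c\<close> avoids dividing by zero.\<close>
    define t where "t = (f v \<bullet> y) / (c + 1)"
    have g: "f v \<bullet> y = t * (c + 1)" using c0 by (simp add: t_def)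
    from le[of t, unfolded g] have "t\<^sup>2 * (c + 2) \<le> 0" by (simp add: power2_eq_square algebra_simps)
    moreover have "t\<^sup>2 * (c + 2) > 0"
      using nz c0 by (intro mult_pos_pos) (auto simp: t_def)
    ultimately show False by simp
  qed
  have fv: "f v = a *\<^sub>R v"
  proof -
    let ?r = "f v - a *\<^sub>R v"
    have r: "?r \<in> S"
      using v sub Suc.prems
      by (auto intro!: subspace_diff subspace_scale)
    have vr: "v \<bullet> ?r = 0"
      using vv by (simp add: a_def inner_diff_right inner_commute)
    have "?r \<bullet> ?r = f v \<bullet> ?r - a * (v \<bullet> ?r)"
      by (simp only: inner_diff_left inner_scaleR_left)
    also have "\<dots> = 0" using stationary[OF r vr] vr by simp
    finally show ?thesis by simp
  qed
  define T where "T = {y \<in> S. v \<bullet> y = 0}"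
  have subT: "subspace T"
    using sub unfolding T_def
    by (auto simp: subspace_def inner_add_right)
  have fT: "f ` T \<subseteq> T"
  proof safe
    fix y assume "y \<in> T"
    then have "f y \<in> S" "v \<bullet> f y = a * (v \<bullet> y)" "v \<bullet> y = 0"
      using Suc.prems sym[of v y] unfolding fv T_def by auto
    then show "f y \<in> T" by (simp add: T_def)
  qed
  have dimT: "dim T = n"
  proof -
    have "T = {y \<in> S. \<forall>x \<in> span {v}. Linear_Algebra.orthogonal x y}"
      by (auto simp: T_def Linear_Algebra.orthogonal_def span_singleton)
    moreover have "v \<noteq> 0"
      using v(2) by auto
    then have "dim (span {v}) = 1"
      by (simp add: dim_insert)
    moreover have "span {v} \<subseteq> S"
      by (simp add: sub v span_minimal)
    ultimately have "dim T + 1 = dim S"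
      using dim_subspace_orthogonal_to_vectors[of "span {v}" S] sub by simp
    then show ?thesis
      using Suc.hyps(2) by simp
  qed
  from Suc.hyps(1)[OF dimT[symmetric] subT fT, unfolded dimT] obtain b l where
    b: "\<forall>i<n. b i \<in> T \<and> f (b i) = l i *\<^sub>R b i" and
    orth: "\<forall>i<n. \<forall>j<n. b i \<bullet> b j = (if i = j then 1 else 0)" and
    l0: "\<forall>i\<ge>n. l i = (0::real)" and
    bound: "\<forall>i. \<forall>y\<in>T. (\<forall>j<min i n. b j \<bullet> y = 0) \<longrightarrow> f y \<bullet> y \<le> l i * (y \<bullet> y)"
    by (elim exE conjE)
  define b' where "b' = case_nat v b"
  define l' where "l' = case_nat a l"
  have 1: "b' i \<in> S \<and> f (b' i) = l' i *\<^sub>R b' i" if "i < Suc n" for i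
    using that v fv b by (cases i) (auto simp: b'_def l'_def T_def)
  have 2: "b' i \<bullet> b' j = (if i = j then 1 else 0)" if "i < Suc n" "j < Suc n" for i j
    using that vv b orth by (cases i; cases j) (auto simp: b'_def T_def inner_commute)
  have 3: "l' i = 0" if "i \<ge> Suc n" for i
    using that l0 by (cases i) (auto simp: l'_def)
  have 4: "f y \<bullet> y \<le> l' i * (y \<bullet> y)"
    if y: "y \<in> S" and o: "\<forall>j<min i (Suc n). b' j \<bullet> y = 0" for i y
  proof (cases i)
    case 0
    then show ?thesis using rayleigh[OF y] by (simp add: l'_def)
  next
    case (Suc m)
    from o have "b' 0 \<bullet> y = 0" using Suc by fastforce
    then have "y \<in> T" using y by (simp add: T_def b'_def)
    moreover have "\<forall>j<min m n. b j \<bullet> y = 0"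
    proof safe
      fix j assume "j < min m n"
      then have "b' (Suc j) \<bullet> y = 0" using o Suc by auto
      then show "b j \<bullet> y = 0" by (simp add: b'_def)
    qed
    ultimately show ?thesis using bound Suc by (simp add: l'_def)
  qed
  show ?case
    unfolding Suc.hyps(2)[symmetric]
  proof (intro exI[of _ b'] exI[of _ l'] conjI allI ballI impI)
    show "b' i \<in> S" "f (b' i) = l' i *\<^sub>R b' i" if "i < Suc n" for i
      using 1[OF that] by blast+
    show "b' i \<bullet> b' j = (if i = j then 1 else 0)" if "i < Suc n" "j < Suc n" for i j
      by (rule 2[OF that])
    show "l' i = 0" if "i \<ge> Suc n" for i
      by (rule 3[OF that])
    show "f y \<bullet> y \<le> l' i * (y \<bullet> y)"
      if "y \<in> S" "\<forall>j<min i (Suc n). b' j \<bullet> y = 0" for i y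
      by (rule 4[OF that])
  qed
qed

section \<open>Eigenvalues of principal submatrices\<close>

lemma nth_eigenvalue_char_poly_split:
  assumes cp: "char_poly A = (\<Prod>a\<leftarrow>es. [:- a, 1:])" and srt: "sorted (rev es)"
  shows "nth_eigenvalue (Suc i) A = (if i < length es then es ! i else 0)"
proof -
  have "proots (char_poly A) = mset es"
    unfolding cp
  proof (induction es)
    case (Cons a es)
    have "(\<Prod>a\<leftarrow>es. [:- a, 1:]) \<noteq> 0"
      by (auto simp: prod_list_zero_iff)
    then have "proots ([:- a, 1:] * (\<Prod>a\<leftarrow>es. [:- a, 1:])) = {#a#} + mset es"
      by (subst proots_mult) (auto simp: Cons.IH)
    then show ?case by simp
  qed simp
  moreover have "sort es = rev es"
    by (rule properties_for_sort) (use srt in auto)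
  ultimately show ?thesis
    by (simp add: nth_eigenvalue_def Let_def)
qed

text \<open>A square matrix with orthonormal columns is invertible, so the eigenvector equation is a
  similarity to a diagonal matrix. In this way multiplicities in the characteristic polynomial agree
  with the number of eigenvectors.\<close>
lemma char_poly_orthonormal_eigenvectors:
  fixes A :: "real mat"
  assumes A: "A \<in> carrier_mat n n" and P: "P \<in> carrier_mat n n"
    and orth: "P\<^sup>T * P = 1\<^sub>m n"
    and eig: "A * P = P * mat n n (\<lambda>(i, j). if i = j then l i else 0)"
  shows "char_poly A = (\<Prod>a\<leftarrow>map l [0..<n]. [:- a, 1:])"
proof -
  let ?D = "mat n n (\<lambda>(i, j). if i = j then l i else 0)"
  have Pt: "P\<^sup>T \<in> carrier_mat n n" using P by simp
  have inv: "P * P\<^sup>T = 1\<^sub>m n"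
    by (rule mat_mult_left_right_inverse[OF Pt P orth])
  have "P * ?D * P\<^sup>T = A * P * P\<^sup>T" by (simp only: eig)
  also have "\<dots> = A * (P * P\<^sup>T)" by (rule assoc_mult_mat[OF A P Pt])
  also have "\<dots> = A" unfolding inv using A by simp
  finally have "A = P * ?D * P\<^sup>T" by simp
  then have "similar_mat A ?D"
    using A P Pt by (intro similar_matI[OF _ inv orth]) auto
  then have "char_poly A = char_poly ?D" by (rule char_poly_similar)
  also have "\<dots> = (\<Prod>a\<leftarrow>diag_mat ?D. [:- a, 1:])"
    by (rule char_poly_upper_triangular[of _ n]) auto
  also have "diag_mat ?D = map l [0..<n]" by (auto simp: diag_mat_def)
  finally show ?thesis .
qed

lemma sum_nth_sorted_list_of_set:
  fixes J :: "'n::{finite, linorder} set" and g :: "'n \<Rightarrow> real"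
  shows "(\<Sum>a<card J. g (sorted_list_of_set J ! a)) = sum g J"
proof -
  have "bij_betw (nth (sorted_list_of_set J)) {..<card J} J"
    by (rule bij_betw_nth) auto
  from sum.reindex_bij_betw[OF this, of g] show ?thesis .
qed

text \<open>
  The matrix \<open>A\<close> lists the entries of \<open>\<sigma>\<close> over \<open>J\<close> in increasing order of the indices, whereas \<open>f\<close> acts
  on vectors over the full index type. As \<open>\<sigma>\<close> vanishes outside \<open>J\<close>, it leaves \<open>S\<close> invariant, and the
  coordinates of an orthonormal eigenbasis of \<open>S\<close> form an orthogonal matrix that diagonalises \<open>A\<close>.
\<close>
lemma principal_submatrix_eigenbasis:
  fixes \<sigma> :: "'n::{finite, linorder} \<Rightarrow> 'n \<Rightarrow> real" and J :: "'n set"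
  assumes sym: "\<And>i j. \<sigma> i j = \<sigma> j i"
    and supp: "\<And>i j. i \<notin> J \<Longrightarrow> \<sigma> i j = 0"
  defines "f \<equiv> (\<lambda>x::real ^ 'n::{finite, linorder}. \<chi> i. \<Sum>j\<in>UNIV. \<sigma> i j * x $ j)"
    and "S \<equiv> {x::real ^ 'n::{finite, linorder}. \<forall>j. j \<notin> J \<longrightarrow> x $ j = 0}"
    and "A \<equiv> mat (card J) (card J)
      (\<lambda>(a, b). \<sigma> (sorted_list_of_set J ! a) (sorted_list_of_set J ! b))"
  shows "\<exists>b. (\<forall>i<card J. b i \<in> S \<and> f (b i) = nth_eigenvalue (Suc i) A *\<^sub>R b i) \<and>
    (\<forall>i<card J. \<forall>j<card J. b i \<bullet> b j = (if i = j then 1 else 0)) \<and>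
    (\<forall>i\<ge>card J. nth_eigenvalue (Suc i) A = 0) \<and>
    (\<forall>i. \<forall>y\<in>S. (\<forall>j<min i (card J). b j \<bullet> y = 0) \<longrightarrow>
       f y \<bullet> y \<le> nth_eigenvalue (Suc i) A * (y \<bullet> y))"
proof -
  let ?n = "card J" and ?e = "sorted_list_of_set J"
  have lin: "linear f"
    by (rule linearI)
      (auto simp: f_def Finite_Cartesian_Product.vec_eq_iff algebra_simps sum.distrib sum_distrib_left)
  have adj: "f x \<bullet> y = x \<bullet> f y" for x y
  proof -
    have "f x \<bullet> y = (\<Sum>i\<in>UNIV. \<Sum>j\<in>UNIV. \<sigma> i j * x $ j * y $ i)"
      by (simp add: f_def inner_vec_def sum_distrib_right)
    also have "\<dots> = (\<Sum>j\<in>UNIV. \<Sum>i\<in>UNIV. \<sigma> i j * x $ j * y $ i)"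
      by (rule sum.swap)
    also have "\<dots> = x \<bullet> f y"
      using sym by (simp add: f_def inner_vec_def sum_distrib_left mult_ac)
    finally show ?thesis .
  qed
  have sub: "subspace S" by (auto simp: subspace_def S_def)
  have inv: "f ` S \<subseteq> S" by (auto simp: f_def S_def supp)
  have dimS: "dim S = ?n"
    unfolding S_def using dim_substandard_cart[where 'a=real and d=J]
    by (simp add: dim_vec_eq)
  from self_adjoint_eigenbasis_on_subspace[OF lin adj sub inv, unfolded dimS] obtain b l where
    b: "\<forall>i<?n. b i \<in> S \<and> f (b i) = l i *\<^sub>R b i" and
    orth: "\<forall>i<?n. \<forall>j<?n. b i \<bullet> b j = (if i = j then 1 else 0)" and
    l0: "\<forall>i\<ge>?n. l i = (0::real)" and
    bound: "\<forall>i. \<forall>y\<in>S. (\<forall>j<min i ?n. b j \<bullet> y = 0) \<longrightarrow> f y \<bullet> y \<le> l i * (y \<bullet> y)"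
    by (elim exE conjE)
  \<comment> \<open>\<open>b j\<close> is orthogonal to the first \<open>i\<close> eigenvectors, so the bound applies to it.\<close>
  have dec: "l j \<le> l i" if "i \<le> j" "j < ?n" for i j
  proof -
    have "f (b j) \<bullet> b j \<le> l i * (b j \<bullet> b j)"
      using that b orth by (intro bound[rule_format]) auto
    then show ?thesis using that b orth by simp
  qed
  define P where "P = mat ?n ?n (\<lambda>(a, i). b i $ (?e ! a))"
  have on_J: "(\<Sum>m\<in>J. g m * b i $ m) = (\<Sum>m\<in>UNIV. g m * b i $ m)" if "i < ?n" for g i
    using b that by (intro sum.mono_neutral_left) (auto simp: S_def)
  have "P\<^sup>T * P = 1\<^sub>m ?n"
  proof (rule eq_matI)
    fix i j assume "i < dim_row (1\<^sub>m ?n :: real mat)" "j < dim_col (1\<^sub>m ?n :: real mat)"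
    then have ij: "i < ?n" "j < ?n" by auto
    then have "(P\<^sup>T * P) $$ (i, j) = (\<Sum>a<?n. b i $ (?e ! a) * b j $ (?e ! a))"
      by (simp add: P_def scalar_prod_def lessThan_atLeast0)
    also have "\<dots> = b i \<bullet> b j"
      using sum_nth_sorted_list_of_set[of "\<lambda>m. b i $ m * b j $ m" J] on_J[OF ij(2)]
      by (simp add: inner_vec_def)
    finally show "(P\<^sup>T * P) $$ (i, j) = 1\<^sub>m ?n $$ (i, j)"
      using ij orth by simp
  qed (auto simp: P_def)
  moreover have "A * P = P * mat ?n ?n (\<lambda>(i, j). if i = j then l i else 0)"
  proof (rule eq_matI)
    fix a i assume "a < dim_row (P * mat ?n ?n (\<lambda>(i, j). if i = j then l i else 0))"
      "i < dim_col (P * mat ?n ?n (\<lambda>(i, j). if i = j then l i else 0))"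
    then have ai: "a < ?n" "i < ?n" by (auto simp: P_def)
    then have "(A * P) $$ (a, i) = (\<Sum>c<?n. \<sigma> (?e ! a) (?e ! c) * b i $ (?e ! c))"
      by (simp add: A_def P_def scalar_prod_def lessThan_atLeast0)
    also have "\<dots> = f (b i) $ (?e ! a)"
      using sum_nth_sorted_list_of_set[of "\<lambda>m. \<sigma> (?e ! a) m * b i $ m" J] on_J[OF ai(2)]
      by (simp add: f_def)
    also have "\<dots> = b i $ (?e ! a) * l i" using b ai by simp
    also have "\<dots> = (\<Sum>c<?n. b c $ (?e ! a) * (if c = i then l c else 0))"
      using ai by (simp add: if_distrib[of "(*) _"] cong: if_cong)
    also have "\<dots> = (P * mat ?n ?n (\<lambda>(i, j). if i = j then l i else 0)) $$ (a, i)"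
      using ai by (simp add: P_def scalar_prod_def lessThan_atLeast0)
    finally show "(A * P) $$ (a, i)
      = (P * mat ?n ?n (\<lambda>(i, j). if i = j then l i else 0)) $$ (a, i)" .
  qed (auto simp: A_def P_def)
  ultimately have cp: "char_poly A = (\<Prod>a\<leftarrow>map l [0..<?n]. [:- a, 1:])"
    by (intro char_poly_orthonormal_eigenvectors[of _ _ P]) (auto simp: A_def P_def)
  have "sorted (rev (map l [0..<?n]))"
    unfolding sorted_rev_iff_nth_mono using dec by auto
  from nth_eigenvalue_char_poly_split[OF cp this]
  have ev: "nth_eigenvalue (Suc i) A = l i" for i
    using l0 by simp
  show ?thesis
    unfolding ev by (intro exI[of _ b] conjI b orth l0 bound)
qed

section \<open>Orthonormal systems\<close>

text \<open>Both inequalities come from the orthogonal projection \<open>w'\<close> of \<open>w\<close> onto the span of \<open>B\<close>: its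
  squared norm is the sum on the right-hand side, and vectors of the span do not distinguish \<open>w\<close> from \<open>w'\<close>.\<close>
lemma orthonormal_projection:
  fixes B :: "'a::euclidean_space set"
  assumes "finite B" and po: "pairwise Linear_Algebra.orthogonal B"
    and nrm: "\<And>u. u \<in> B \<Longrightarrow> norm u = 1"
  shows Bessel_inequality: "(\<Sum>u\<in>B. (u \<bullet> w)\<^sup>2) \<le> w \<bullet> w"
    and inner_in_span_le: "x \<in> span B \<Longrightarrow> (x \<bullet> w)\<^sup>2 \<le> (x \<bullet> x) * (\<Sum>u\<in>B. (u \<bullet> w)\<^sup>2)"
proof -
  define w' where "w' = (\<Sum>u\<in>B. (u \<bullet> w) *\<^sub>R u)"
  have uw': "u \<bullet> w' = u \<bullet> w" if "u \<in> B" for u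
  proof -
    have "u \<bullet> w' = (\<Sum>t\<in>B. if t = u then t \<bullet> w else 0)"
      unfolding w'_def inner_sum_right
      using po nrm that
      by (intro sum.cong) (auto simp: pairwise_def Linear_Algebra.orthogonal_def dot_square_norm)
    then show ?thesis using that \<open>finite B\<close> by simp
  qed
  have ww': "w \<bullet> w' = (\<Sum>u\<in>B. (u \<bullet> w)\<^sup>2)"
    by (simp add: w'_def inner_sum_right power2_eq_square inner_commute)
  have "w' \<bullet> w' = (\<Sum>u\<in>B. (u \<bullet> w) * (u \<bullet> w'))"
    by (subst (1) w'_def) (simp add: inner_sum_left)
  then have w'w': "w' \<bullet> w' = (\<Sum>u\<in>B. (u \<bullet> w)\<^sup>2)"
    by (simp add: uw' power2_eq_square)
  have "0 \<le> (w - w') \<bullet> (w - w')" by simp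
  also have "\<dots> = w \<bullet> w - 2 * (w \<bullet> w') + w' \<bullet> w'"
    by (simp add: inner_diff inner_commute)
  finally show "(\<Sum>u\<in>B. (u \<bullet> w)\<^sup>2) \<le> w \<bullet> w"
    by (simp add: ww' w'w')
  show "(x \<bullet> w)\<^sup>2 \<le> (x \<bullet> x) * (\<Sum>u\<in>B. (u \<bullet> w)\<^sup>2)" if "x \<in> span B"
  proof -
    have x: "(\<Sum>u\<in>B. (x \<bullet> u) *\<^sub>R u) = x"
      by (rule orthonormal_basis_expand[OF po nrm that \<open>finite B\<close>])
    have "x \<bullet> w = (\<Sum>u\<in>B. (x \<bullet> u) * (u \<bullet> w))"
      by (subst x[symmetric]) (simp add: inner_sum_left)
    also have "\<dots> = (\<Sum>u\<in>B. (x \<bullet> u) * (u \<bullet> w'))"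
      by (simp add: uw')
    also have "\<dots> = x \<bullet> w'"
      by (subst (2) x[symmetric]) (simp add: inner_sum_left)
    finally show ?thesis
      using Cauchy_Schwarz_ineq[of x w'] by (simp add: w'w')
  qed
qed

section \<open>Coordinate subspaces and faces\<close>

definition coordinate_subspace :: "'n set \<Rightarrow> (real ^ 'n) set" where
  "coordinate_subspace J = {x. \<forall>j. j \<notin> J \<longrightarrow> x $ j = 0}"

definition coordinate_proj :: "'n set \<Rightarrow> real ^ 'n \<Rightarrow> real ^ 'n" where
  "coordinate_proj J x = (\<chi> j. if j \<in> J then x $ j else 0)"

lemma closed_face: "closed (face J :: (real ^ 'n) set)"
  unfolding face_def
  by (intro closed_Collect_conj closed_Collect_all closed_Collect_le closed_Collect_imp
      closed_Collect_eq open_Collect_const continuous_intros)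

lemma face_subset_coordinate_subspace: "x \<in> face J \<Longrightarrow> x \<in> coordinate_subspace J"
  by (simp add: face_def coordinate_subspace_def)

lemma inner_coordinate_proj:
  "x \<in> coordinate_subspace J \<Longrightarrow> coordinate_proj J u \<bullet> x = u \<bullet> x"
  unfolding inner_vec_def coordinate_subspace_def coordinate_proj_def
  by (intro sum.cong) auto

lemma coordinate_proj_in: "coordinate_proj J u \<in> coordinate_subspace J"
  by (simp add: coordinate_subspace_def coordinate_proj_def)

lemma sum_inner_coordinate_proj:
  fixes u :: "real ^ 'n"
  assumes "finite K" and "disjoint_family_on I K" and "(\<Union>i\<in>K. I i) = UNIV"
  shows "(\<Sum>i\<in>K. coordinate_proj (I i) u \<bullet> coordinate_proj (I i) u) = u \<bullet> u"
proof -
  have "coordinate_proj J u \<bullet> coordinate_proj J u = (\<Sum>j\<in>J. u $ j * u $ j)" for J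
  proof -
    have "coordinate_proj J u \<bullet> coordinate_proj J u = (\<Sum>j\<in>UNIV. if j \<in> J then u $ j * u $ j else 0)"
      unfolding inner_vec_def coordinate_proj_def by (intro sum.cong) auto
    then show ?thesis by (simp add: sum.If_cases)
  qed
  then have "(\<Sum>i\<in>K. coordinate_proj (I i) u \<bullet> coordinate_proj (I i) u)
      = (\<Sum>i\<in>K. \<Sum>j\<in>I i. u $ j * u $ j)"
    by simp
  also have "\<dots> = (\<Sum>j\<in>(\<Union>i\<in>K. I i). u $ j * u $ j)"
    using assms by (intro sum.UNION_disjoint[symmetric]) (auto simp: disjoint_family_on_def)
  finally show ?thesis by (simp add: assms(3) inner_vec_def)
qed

section \<open>The second moment on a face\<close>

lemma (in prob_space) integral_uniform_measure:
  fixes g :: "'a \<Rightarrow> real"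
  assumes A: "A \<in> events" and pos: "prob A > 0" and g: "g \<in> borel_measurable M"
  shows "(\<integral>x. g x \<partial>uniform_measure M A) = (\<integral>x. indicator A x * g x \<partial>M) / prob A"
proof -
  have "uniform_measure M A = density M (\<lambda>x. ennreal (indicator A x / prob A))"
    unfolding uniform_measure_def
    using A pos divide_ennreal[of 1 "prob A"]
    by (intro density_cong) (auto simp: emeasure_eq_measure split: split_indicator)
  then have "(\<integral>x. g x \<partial>uniform_measure M A) = (\<integral>x. (indicator A x / prob A) *\<^sub>R g x \<partial>M)"
    using A g by (simp add: integral_density)
  then show ?thesis by simp
qed

locale nonneg_sphere_vector = prob_space M
  for M :: "'a measure" +
  fixes X :: "'a \<Rightarrow> real ^ 'n::{finite, linorder}"
  assumes X_measurable [measurable]: "X \<in> borel_measurable M"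
    and X_sphere: "\<And>\<omega>. \<omega> \<in> space M \<Longrightarrow> X \<omega> \<in> nonneg_sphere"
begin

definition face_event :: "'n set \<Rightarrow> 'a set" where
  "face_event J = {\<omega> \<in> space M. X \<omega> \<in> face J}"

text \<open>The quadratic form of the matrix \<open>p\<^sub>J \<Sigma>\<^sub>J\<close>, with \<open>\<Sigma>\<^sub>J\<close> the cross-moment matrix of the submodel,
  extended by zero to all coordinates. Integrals without conditioning are used because they add up over
  the faces to the second moment of \<open>X\<close>.\<close>
definition face_moment where
  "face_moment J u = (\<integral>\<omega>. indicator (face_event J) \<omega> * (u \<bullet> X \<omega>)\<^sup>2 \<partial>M)"

lemma face_event_sets [measurable]: "face_event J \<in> events"
  unfolding face_event_def
  using measurable_sets[OF X_measurable, of "face J"] closed_face[of J]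
  by (auto simp: vimage_def Int_def conj_commute)

lemma X_comp_measurable [measurable]: "(\<lambda>\<omega>. X \<omega> $ j) \<in> borel_measurable M"
proof -
  have "(\<lambda>\<omega>. X \<omega> \<bullet> axis j 1) \<in> borel_measurable M" by measurable
  then show ?thesis by (simp add: inner_axis)
qed

lemma X_nonneg: "\<omega> \<in> space M \<Longrightarrow> 0 \<le> X \<omega> $ j"
  and X_norm: "\<omega> \<in> space M \<Longrightarrow> norm (X \<omega>) = 1"
  using X_sphere by (auto simp: nonneg_sphere_def)

lemma X_le_1: "\<omega> \<in> space M \<Longrightarrow> X \<omega> $ j \<le> 1"
  using component_le_norm_cart[of "X \<omega>" j] X_norm by force

lemma inner_X_bound: "\<omega> \<in> space M \<Longrightarrow> \<bar>u \<bullet> X \<omega>\<bar> \<le> norm u"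
  using Cauchy_Schwarz_ineq2[of u "X \<omega>"] by (simp add: X_norm)

lemma inner_X_sq_bound: "\<omega> \<in> space M \<Longrightarrow> (u \<bullet> X \<omega>)\<^sup>2 \<le> (norm u)\<^sup>2"
  using inner_X_bound[of \<omega> u] by (simp add: abs_le_square_iff[symmetric])

lemma integrable_inner_sq [simp]: "integrable M (\<lambda>\<omega>. (u \<bullet> X \<omega>)\<^sup>2)"
  using inner_X_sq_bound[of _ u] by (intro integrable_const_bound[of _ "(norm u)\<^sup>2"]) auto

lemma integrable_face_inner_sq [simp]:
  "integrable M (\<lambda>\<omega>. indicator (face_event J) \<omega> * (u \<bullet> X \<omega>)\<^sup>2)"
  using inner_X_sq_bound[of _ u]
  by (intro integrable_const_bound[of _ "(norm u)\<^sup>2"]) (auto split: split_indicator)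

lemma integrable_face_prod [simp]:
  "integrable M (\<lambda>\<omega>. indicator (face_event J) \<omega> * (X \<omega> $ i * X \<omega> $ j))"
  by (intro integrable_const_bound[of _ 1])
    (auto split: split_indicator simp: abs_mult X_nonneg X_le_1 intro!: mult_le_one)

lemma face_moment_nonneg: "0 \<le> face_moment J u"
  unfolding face_moment_def by (intro integral_nonneg_AE) auto

lemma face_moment_proj: "face_moment J (coordinate_proj J u) = face_moment J u"
  unfolding face_moment_def
  by (intro Bochner_Integration.integral_cong)
    (auto split: split_indicator
      simp: face_event_def inner_coordinate_proj face_subset_coordinate_subspace)

text \<open>Conditioning and restricting amount to integrating over the face and dividing by its
  probability.\<close>
lemma cross_moment_eq:
  assumes "face_prob M X J > 0"
  shows "cross_moment M X J = mat (card J) (card J) (\<lambda>(a, b).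
    (\<integral>\<omega>. indicator (face_event J) \<omega> *
       (X \<omega> $ (sorted_list_of_set J ! a) * X \<omega> $ (sorted_list_of_set J ! b)) \<partial>M)
    / face_prob M X J)"
  unfolding cross_moment_def
proof (rule cong_mat; clarsimp)
  fix a b assume ab: "a < card J" "b < card J"
  let ?i = "sorted_list_of_set J ! a" and ?j = "sorted_list_of_set J ! b"
  let ?U = "uniform_measure M (face_event J)"
  have J: "?i \<in> J" "?j \<in> J"
    using ab nth_mem[of _ "sorted_list_of_set J"] by auto
  have mes: "(\<lambda>\<omega>. restrict (vec_nth (X \<omega>)) J) \<in> measurable ?U (Pi\<^sub>M J (\<lambda>_. borel))"
    by (intro measurable_restrict) simp
  have "(\<integral>z. z ?i * z ?j \<partial>submodel_law M X J)
    = (\<integral>\<omega>. restrict (vec_nth (X \<omega>)) J ?i * restrict (vec_nth (X \<omega>)) J ?j \<partial>?U)"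
    unfolding submodel_law_def face_event_def[symmetric]
    using J by (intro integral_distr[OF mes]) measurable
  also have "\<dots> = (\<integral>\<omega>. X \<omega> $ ?i * X \<omega> $ ?j \<partial>?U)"
    using J by simp
  also have "\<dots> = (\<integral>\<omega>. indicator (face_event J) \<omega> * (X \<omega> $ ?i * X \<omega> $ ?j) \<partial>M)
      / prob (face_event J)"
    using assms
    by (intro integral_uniform_measure face_event_sets) (simp_all add: face_prob_def face_event_def)
  finally show "(\<integral>z. z ?i * z ?j \<partial>submodel_law M X J)
    = (\<integral>\<omega>. indicator (face_event J) \<omega> * (X \<omega> $ ?i * X \<omega> $ ?j) \<partial>M) / face_prob M X J"
    by (simp add: face_prob_def face_event_def)
qed

text \<open>
  Only a top eigenvector \<open>v\<close> is kept from the eigenbasis: the cross term between \<open>t v\<close> and a vector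
  orthogonal to \<open>v\<close> vanishes, and on the orthogonal complement the second eigenvalue controls the form. The bound
  \<open>0 \<le> c\<close> covers blocks of size one too, where the second eigenvalue is zero by convention. It matters
  when the centroids span fewer than \<open>k\<close> dimensions.
\<close>
lemma face_moment_spectral:
  fixes J
  assumes p: "face_prob M X J > 0" and "J \<noteq> {}"
  defines "a \<equiv> face_prob M X J * nth_eigenvalue 1 (cross_moment M X J)"
    and "c \<equiv> face_prob M X J * nth_eigenvalue 2 (cross_moment M X J)"
  shows "\<exists>v \<in> coordinate_subspace J. norm v = 1 \<and> face_moment J v = a \<and>
    (\<forall>y \<in> coordinate_subspace J. face_moment J y \<le> a * (y \<bullet> y)) \<and>
    (\<forall>y \<in> coordinate_subspace J. \<forall>t. v \<bullet> y = 0 \<longrightarrow>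
       face_moment J (t *\<^sub>R v + y) \<le> t\<^sup>2 * a + c * (y \<bullet> y))"
    and "0 \<le> c"
proof -
  let ?F = "indicator (face_event J) :: 'a \<Rightarrow> real"
  let ?p = "face_prob M X J" and ?A = "cross_moment M X J" and ?S = "coordinate_subspace J"
  define \<sigma> where "\<sigma> i j = (\<integral>\<omega>. ?F \<omega> * (X \<omega> $ i * X \<omega> $ j) \<partial>M) / ?p" for i j
  define f where "f x = (\<chi> i. \<Sum>j\<in>UNIV. \<sigma> i j * x $ j)" for x
  have sym: "\<sigma> i j = \<sigma> j i" for i j by (simp add: \<sigma>_def mult_ac)
  have supp: "\<sigma> i j = 0" if "i \<notin> J" for i j
  proof -
    have "(\<integral>\<omega>. ?F \<omega> * (X \<omega> $ i * X \<omega> $ j) \<partial>M) = (\<integral>\<omega>. 0 \<partial>M)"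
      using that by (intro Bochner_Integration.integral_cong)
        (auto split: split_indicator simp: face_event_def face_def)
    then show ?thesis by (simp add: \<sigma>_def)
  qed
  have q: "face_moment J y = ?p * (f y \<bullet> y)" for y
  proof -
    have "f y \<bullet> y * ?p = (\<Sum>i\<in>UNIV. \<Sum>j\<in>UNIV. (\<sigma> i j * ?p) * (y $ i * y $ j))"
      by (simp add: f_def inner_vec_def sum_distrib_left sum_distrib_right mult_ac)
    also have "\<dots> = (\<Sum>i\<in>UNIV. \<Sum>j\<in>UNIV. (\<integral>\<omega>. ?F \<omega> * (X \<omega> $ i * X \<omega> $ j) \<partial>M) * (y $ i * y $ j))"
      using p by (simp add: \<sigma>_def)
    also have "\<dots> = (\<Sum>i\<in>UNIV. \<Sum>j\<in>UNIV. (\<integral>\<omega>. ?F \<omega> * (X \<omega> $ i * X \<omega> $ j) * (y $ i * y $ j) \<partial>M))"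
      by simp
    also have "\<dots> = (\<Sum>i\<in>UNIV. (\<integral>\<omega>. (\<Sum>j\<in>UNIV. ?F \<omega> * (X \<omega> $ i * X \<omega> $ j) * (y $ i * y $ j)) \<partial>M))"
      by (intro sum.cong Bochner_Integration.integral_sum[symmetric] integrable_mult_left) auto
    also have "\<dots> = (\<integral>\<omega>. (\<Sum>i\<in>UNIV. \<Sum>j\<in>UNIV. ?F \<omega> * (X \<omega> $ i * X \<omega> $ j) * (y $ i * y $ j)) \<partial>M)"
      by (intro Bochner_Integration.integral_sum[symmetric] Bochner_Integration.integrable_sum
          integrable_mult_left) auto
    also have "\<dots> = face_moment J y"
      unfolding face_moment_def
      by (intro Bochner_Integration.integral_cong)
        (simp_all add: inner_vec_def power2_eq_square sum_product sum_distrib_left mult_ac)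
    finally show ?thesis by (simp add: mult_ac)
  qed
  have A: "?A = mat (card J) (card J)
      (\<lambda>(a, b). \<sigma> (sorted_list_of_set J ! a) (sorted_list_of_set J ! b))"
    by (simp add: cross_moment_eq[OF p] \<sigma>_def)
  have n: "0 < card J" using \<open>J \<noteq> {}\<close> by (simp add: card_gt_0_iff)
  from principal_submatrix_eigenbasis[of \<sigma> J, OF sym supp, folded A f_def coordinate_subspace_def]
  obtain b where
    b: "\<forall>i<card J. b i \<in> ?S \<and> f (b i) = nth_eigenvalue (Suc i) ?A *\<^sub>R b i" and
    orth: "\<forall>i<card J. \<forall>j<card J. b i \<bullet> b j = (if i = j then 1 else 0)" and
    l0: "\<forall>i\<ge>card J. nth_eigenvalue (Suc i) ?A = 0" and
    bound: "\<forall>i. \<forall>y\<in>?S. (\<forall>j<min i (card J). b j \<bullet> y = 0) \<longrightarrow>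
       f y \<bullet> y \<le> nth_eigenvalue (Suc i) ?A * (y \<bullet> y)"
    by - (drule meta_mp, assumption, elim exE conjE)
  let ?l1 = "nth_eigenvalue 1 ?A" and ?l2 = "nth_eigenvalue 2 ?A"
  have v: "b 0 \<in> ?S" "f (b 0) = ?l1 *\<^sub>R b 0" "b 0 \<bullet> b 0 = 1"
    using b orth n by auto
  show "0 \<le> c"
  proof (cases "card J \<le> 1")
    case True
    then have "nth_eigenvalue (Suc 1) ?A = 0" using l0 by blast
    then show ?thesis by (simp add: c_def numeral_2_eq_2)
  next
    case False
    then have "f (b 1) = ?l2 *\<^sub>R b 1" "b 1 \<bullet> b 1 = 1"
      using b orth by (auto simp: numeral_2_eq_2)
    then have "face_moment J (b 1) = c" by (simp add: q c_def)
    then show ?thesis using face_moment_nonneg[of J "b 1"] by simp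
  qed
  show "\<exists>v \<in> ?S. norm v = 1 \<and> face_moment J v = a \<and>
    (\<forall>y \<in> ?S. face_moment J y \<le> a * (y \<bullet> y)) \<and>
    (\<forall>y \<in> ?S. \<forall>t. v \<bullet> y = 0 \<longrightarrow> face_moment J (t *\<^sub>R v + y) \<le> t\<^sup>2 * a + c * (y \<bullet> y))"
  proof (intro bexI[of _ "b 0"] conjI ballI allI impI v(1))
    show "norm (b 0) = 1" using v(3) by (simp add: norm_eq_1)
    show "face_moment J (b 0) = a" using v by (simp add: q a_def)
    show "face_moment J y \<le> a * (y \<bullet> y)" if "y \<in> ?S" for y
      using bound[rule_format, of y 0] that p by (simp add: q a_def)
    show "face_moment J (t *\<^sub>R b 0 + y) \<le> t\<^sup>2 * a + c * (y \<bullet> y)"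
      if "y \<in> ?S" "b 0 \<bullet> y = 0" for y t
    proof -
      have "f y \<bullet> y \<le> ?l2 * (y \<bullet> y)"
        using bound[rule_format, of y 1] that by (auto simp: numeral_2_eq_2)
      then have le: "face_moment J y \<le> c * (y \<bullet> y)" using p by (simp add: q c_def)
      have lin: "f (t *\<^sub>R b 0 + y) = t *\<^sub>R f (b 0) + f y"
        by (simp add: f_def Finite_Cartesian_Product.vec_eq_iff sum.distrib sum_distrib_left
            distrib_left mult_ac)
      have "f y \<bullet> b 0 = y \<bullet> f (b 0)"
      proof -
        have "f y \<bullet> b 0 = (\<Sum>i\<in>UNIV. \<Sum>j\<in>UNIV. \<sigma> i j * y $ j * b 0 $ i)"
          by (simp add: f_def inner_vec_def sum_distrib_right)
        also have "\<dots> = (\<Sum>j\<in>UNIV. \<Sum>i\<in>UNIV. \<sigma> i j * y $ j * b 0 $ i)"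
          by (rule sum.swap)
        also have "\<dots> = y \<bullet> f (b 0)"
          using sym by (simp add: f_def inner_vec_def sum_distrib_left mult_ac)
        finally show ?thesis .
      qed
      then have "f y \<bullet> b 0 = 0" using that v(2) by (simp add: inner_commute)
      then have "f (t *\<^sub>R b 0 + y) \<bullet> (t *\<^sub>R b 0 + y) = t\<^sup>2 * ?l1 + f y \<bullet> y"
        using v that by (simp add: lin inner_add power2_eq_square inner_commute)
      then have "face_moment J (t *\<^sub>R b 0 + y) = t\<^sup>2 * a + face_moment J y"
        by (simp add: q a_def algebra_simps)
      with le show ?thesis by simp
    qed
  qed
qed

end

section \<open>Optimal centroids for vectors supported on a partition into faces\<close>

locale face_partitioned_vector = nonneg_sphere_vector M X
  for M :: "'a measure" and X :: "'a \<Rightarrow> real ^ 'n::{finite, linorder}" +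
  fixes k :: nat and I :: "nat \<Rightarrow> 'n set"
  assumes k_pos: "1 \<le> k"
    and I_nonempty: "\<And>i. i \<in> {1..k} \<Longrightarrow> I i \<noteq> {}"
    and I_disjoint: "disjoint_family_on I {1..k}"
    and I_cover: "(\<Union>i\<in>{1..k}. I i) = UNIV"
    and X_on_faces: "\<P>(\<omega> in M. X \<omega> \<in> (\<Union>i\<in>{1..k}. face (I i))) = 1"
begin

text \<open>A point of two different faces of the partition would be zero, but \<open>X\<close> has norm one.\<close>
lemma face_events_disjoint:
  assumes "i \<in> {1..k}" "j \<in> {1..k}" "\<omega> \<in> face_event (I i)" "\<omega> \<in> face_event (I j)"
  shows "i = j"
proof (rule ccontr)
  assume "i \<noteq> j"
  then have "I i \<inter> I j = {}"
    using I_disjoint assms by (auto simp: disjoint_family_on_def)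
  then have "X \<omega> = 0"
    using assms by (auto simp: Finite_Cartesian_Product.vec_eq_iff face_event_def face_def)
  then show False
    using X_norm[of \<omega>] assms by (simp add: face_event_def)
qed

lemma AE_exists_face_event: "AE \<omega> in M. \<exists>i\<in>{1..k}. \<omega> \<in> face_event (I i)"
proof -
  have eq: "{\<omega> \<in> space M. X \<omega> \<in> (\<Union>i\<in>{1..k}. face (I i))} = (\<Union>i\<in>{1..k}. face_event (I i))"
    by (auto simp: face_event_def)
  have "prob (\<Union>i\<in>{1..k}. face_event (I i)) = 1"
    using X_on_faces unfolding eq .
  then have "AE \<omega> in M. \<omega> \<in> (\<Union>i\<in>{1..k}. face_event (I i))"
    by (subst (asm) prob_eq_1) auto
  then show ?thesis by simp
qed

lemma integral_face_decomposition:
  fixes g :: "'a \<Rightarrow> real"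
  assumes g: "integrable M g"
  shows "(\<integral>\<omega>. g \<omega> \<partial>M) = (\<Sum>i\<in>{1..k}. \<integral>\<omega>. indicator (face_event (I i)) \<omega> * g \<omega> \<partial>M)"
proof -
  have int: "integrable M (\<lambda>\<omega>. indicator (face_event (I i)) \<omega> * g \<omega>)" for i
    using integrable_mult_indicator[OF face_event_sets g] by simp
  have "AE \<omega> in M. g \<omega> = (\<Sum>i\<in>{1..k}. indicator (face_event (I i)) \<omega> * g \<omega>)"
    using AE_exists_face_event
  proof eventually_elim
    case (elim \<omega>)
    then obtain j where j: "j \<in> {1..k}" "\<omega> \<in> face_event (I j)" by blast
    have "(\<Sum>i\<in>{1..k}. indicator (face_event (I i)) \<omega> * g \<omega>)
      = (\<Sum>i\<in>{1..k}. if i = j then g \<omega> else 0)"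
    proof (rule sum.cong)
      fix i assume "i \<in> {1..k}"
      then have "\<omega> \<in> face_event (I i) \<longleftrightarrow> i = j"
        using face_events_disjoint[of i j \<omega>] j by blast
      then show "indicator (face_event (I i)) \<omega> * g \<omega> = (if i = j then g \<omega> else 0)"
        by (simp add: indicator_def)
    qed simp
    then show ?case using j by simp
  qed
  then have "(\<integral>\<omega>. g \<omega> \<partial>M) = (\<integral>\<omega>. (\<Sum>i\<in>{1..k}. indicator (face_event (I i)) \<omega> * g \<omega>) \<partial>M)"
    using g int
    by (intro integral_cong_AE borel_measurable_sum borel_measurable_integrable) auto
  also have "\<dots> = (\<Sum>i\<in>{1..k}. \<integral>\<omega>. indicator (face_event (I i)) \<omega> * g \<omega> \<partial>M)"
    by (intro Bochner_Integration.integral_sum int)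
  finally show ?thesis .
qed

text \<open>The second moment splits over the blocks. In each block, \<open>u\<close> is decomposed into its component \<open>t v\<^sub>i\<close> along the
  top eigenvector and a remainder \<open>y\<close>, with \<open>\<parallel>y\<parallel>\<^sup>2\<close> equal to \<open>\<parallel>u\<^sub>I\<parallel>\<^sup>2 - t\<^sup>2\<close>, where \<open>u\<^sub>I\<close> is the part of \<open>u\<close> in
  the block.\<close>
lemma second_moment_le:
  assumes v: "\<And>i. i \<in> {1..k} \<Longrightarrow> v i \<in> coordinate_subspace (I i) \<and> norm (v i) = 1 \<and>
      (\<forall>y \<in> coordinate_subspace (I i). \<forall>t. v i \<bullet> y = 0 \<longrightarrow>
         face_moment (I i) (t *\<^sub>R v i + y) \<le> t\<^sup>2 * a i + c * (y \<bullet> y))"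
  shows "(\<integral>\<omega>. (u \<bullet> X \<omega>)\<^sup>2 \<partial>M) \<le> c * (u \<bullet> u) + (\<Sum>i\<in>{1..k}. (a i - c) * (u \<bullet> v i)\<^sup>2)"
proof -
  have "(\<integral>\<omega>. (u \<bullet> X \<omega>)\<^sup>2 \<partial>M) = (\<Sum>i\<in>{1..k}. face_moment (I i) u)"
    unfolding face_moment_def by (rule integral_face_decomposition) simp
  also have "\<dots> \<le> (\<Sum>i\<in>{1..k}. c * (coordinate_proj (I i) u \<bullet> coordinate_proj (I i) u)
      + (a i - c) * (u \<bullet> v i)\<^sup>2)"
  proof (rule sum_mono)
    fix i assume i: "i \<in> {1..k}"
    define w t y where "w = coordinate_proj (I i) u" and "t = u \<bullet> v i" and "y = w - t *\<^sub>R v i"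
    have vv: "v i \<bullet> v i = 1" using v[OF i] by (simp add: dot_square_norm)
    have wv: "w \<bullet> v i = t"
      using v[OF i] by (simp add: w_def t_def inner_coordinate_proj)
    have y: "y \<in> coordinate_subspace (I i)"
      using v[OF i] coordinate_proj_in[of "I i" u]
      by (simp add: y_def w_def coordinate_subspace_def)
    have vy: "v i \<bullet> y = 0"
      using wv vv by (simp add: y_def inner_diff_right inner_commute)
    have yy: "y \<bullet> y = w \<bullet> w - t\<^sup>2"
      using wv vv by (simp add: y_def inner_diff inner_commute power2_eq_square)
    have "face_moment (I i) u = face_moment (I i) (t *\<^sub>R v i + y)"
      by (simp add: y_def w_def face_moment_proj)
    also have "\<dots> \<le> t\<^sup>2 * a i + c * (y \<bullet> y)"
      using v[OF i] y vy by blast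
    also have "\<dots> = c * (w \<bullet> w) + (a i - c) * t\<^sup>2"
      by (simp add: yy algebra_simps)
    finally show "face_moment (I i) u \<le> c * (coordinate_proj (I i) u \<bullet> coordinate_proj (I i) u)
      + (a i - c) * (u \<bullet> v i)\<^sup>2"
      by (simp add: w_def t_def)
  qed
  also have "\<dots> = c * (u \<bullet> u) + (\<Sum>i\<in>{1..k}. (a i - c) * (u \<bullet> v i)\<^sup>2)"
    by (simp only: sum.distrib sum_distrib_left[symmetric]
        sum_inner_coordinate_proj[OF finite_atLeastAtMost I_disjoint I_cover])
  finally show ?thesis .
qed

lemma Max_inner_sq_integrable:
  "integrable M (\<lambda>\<omega>. MAX i\<in>{1..k}. (x i \<bullet> X \<omega>)\<^sup>2)"
proof (rule Bochner_Integration.integrable_bound)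
  show "integrable M (\<lambda>\<omega>. \<Sum>i\<in>{1..k}. (x i \<bullet> X \<omega>)\<^sup>2)" by simp
  show "(\<lambda>\<omega>. MAX i\<in>{1..k}. (x i \<bullet> X \<omega>)\<^sup>2) \<in> borel_measurable M"
    by (intro borel_measurable_Max) auto
  have "\<bar>MAX i\<in>{1..k}. (x i \<bullet> X \<omega>)\<^sup>2\<bar> \<le> \<bar>\<Sum>i\<in>{1..k}. (x i \<bullet> X \<omega>)\<^sup>2\<bar>" for \<omega>
  proof -
    have "(MAX i\<in>{1..k}. (x i \<bullet> X \<omega>)\<^sup>2) \<in> (\<lambda>i. (x i \<bullet> X \<omega>)\<^sup>2) ` {1..k}"
      using k_pos by (intro Max_in) auto
    then obtain j where j: "j \<in> {1..k}" "(MAX i\<in>{1..k}. (x i \<bullet> X \<omega>)\<^sup>2) = (x j \<bullet> X \<omega>)\<^sup>2"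
      by auto
    have "(x j \<bullet> X \<omega>)\<^sup>2 \<le> (\<Sum>i\<in>{1..k}. (x i \<bullet> X \<omega>)\<^sup>2)"
      using j by (intro member_le_sum) auto
    then show ?thesis using j by (simp add: sum_nonneg)
  qed
  then show "AE \<omega> in M. norm (MAX i\<in>{1..k}. (x i \<bullet> X \<omega>)\<^sup>2) \<le> norm (\<Sum>i\<in>{1..k}. (x i \<bullet> X \<omega>)\<^sup>2)"
    by simp
qed

text \<open>The Ky Fan step. The centroids enter only through their span: projecting \<open>X\<close> onto it dominates
  every \<open>(x\<^sub>i \<bullet> X)\<^sup>2\<close>. The weights \<open>a\<^sub>i - c\<close> are non-negative, so the Bessel inequality for \<open>v\<^sub>i\<close> can be
  applied term by term; \<open>c \<ge> 0\<close> allows replacing the dimension of the span by \<open>k\<close>.\<close>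
lemma clustering_value_le:
  assumes mom: "\<And>u. (\<integral>\<omega>. (u \<bullet> X \<omega>)\<^sup>2 \<partial>M) \<le> c * (u \<bullet> u) + (\<Sum>i\<in>{1..k}. (a i - c) * (u \<bullet> v i)\<^sup>2)"
    and v: "\<And>i. i \<in> {1..k} \<Longrightarrow> norm (v i) = 1"
    and c: "0 \<le> c" "\<And>i. i \<in> {1..k} \<Longrightarrow> c \<le> a i"
    and x: "\<And>i. i \<in> {1..k} \<Longrightarrow> norm (x i) = 1"
  shows "clustering_value M X k x \<le> (\<Sum>i\<in>{1..k}. a i)"
proof -
  obtain B where B: "B \<subseteq> span (x ` {1..k})" "pairwise Linear_Algebra.orthogonal B"
      "\<And>u. u \<in> B \<Longrightarrow> norm u = 1" "independent B" "card B = dim (span (x ` {1..k}))"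
      "span B = span (x ` {1..k})"
    using orthonormal_basis_subspace[of "span (x ` {1..k})"] by auto
  have fin: "finite B" using B(4) by (rule independent_imp_finite)
  have "card B \<le> card (x ` {1..k})"
    using B(5) dim_le_card'[of "x ` {1..k}"] by simp
  also have "\<dots> \<le> k" using card_image_le[of "{1..k}" x] by simp
  finally have cardB: "card B \<le> k" .
  have "clustering_value M X k x \<le> (\<integral>\<omega>. (\<Sum>u\<in>B. (u \<bullet> X \<omega>)\<^sup>2) \<partial>M)"
    unfolding clustering_value_def
  proof (rule integral_mono)
    show "integrable M (\<lambda>\<omega>. MAX i\<in>{1..k}. (x i \<bullet> X \<omega>)\<^sup>2)" by (rule Max_inner_sq_integrable)
    show "integrable M (\<lambda>\<omega>. \<Sum>u\<in>B. (u \<bullet> X \<omega>)\<^sup>2)" by simp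
    fix \<omega>
    have "(x i \<bullet> X \<omega>)\<^sup>2 \<le> (\<Sum>u\<in>B. (u \<bullet> X \<omega>)\<^sup>2)" if "i \<in> {1..k}" for i
    proof -
      have "x i \<in> span B" using that B(6) by (simp add: span_base)
      from inner_in_span_le[OF fin B(2,3) this, of "X \<omega>"] show ?thesis
        using x[OF that] by (simp add: dot_square_norm)
    qed
    then show "(MAX i\<in>{1..k}. (x i \<bullet> X \<omega>)\<^sup>2) \<le> (\<Sum>u\<in>B. (u \<bullet> X \<omega>)\<^sup>2)"
      using k_pos by (subst Max_le_iff) auto
  qed
  also have "\<dots> = (\<Sum>u\<in>B. \<integral>\<omega>. (u \<bullet> X \<omega>)\<^sup>2 \<partial>M)"
    by (intro Bochner_Integration.integral_sum) simp
  also have "\<dots> \<le> (\<Sum>u\<in>B. c + (\<Sum>i\<in>{1..k}. (a i - c) * (u \<bullet> v i)\<^sup>2))"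
  proof (rule sum_mono)
    fix u assume "u \<in> B"
    then have "u \<bullet> u = 1" using B(3) by (simp add: dot_square_norm)
    then show "(\<integral>\<omega>. (u \<bullet> X \<omega>)\<^sup>2 \<partial>M) \<le> c + (\<Sum>i\<in>{1..k}. (a i - c) * (u \<bullet> v i)\<^sup>2)"
      using mom[of u] by simp
  qed
  also have "\<dots> = c * card B + (\<Sum>i\<in>{1..k}. (a i - c) * (\<Sum>u\<in>B. (u \<bullet> v i)\<^sup>2))"
    by (simp add: sum.distrib sum_distrib_left sum.swap[of _ B])
  also have "\<dots> \<le> c * k + (\<Sum>i\<in>{1..k}. (a i - c) * 1)"
  proof (intro add_mono sum_mono mult_left_mono)
    show "(\<Sum>u\<in>B. (u \<bullet> v i)\<^sup>2) \<le> 1" if "i \<in> {1..k}" for i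
      using Bessel_inequality[OF fin B(2,3), of "v i"] v[OF that] by (simp add: dot_square_norm)
  qed (use c cardB in auto)
  also have "\<dots> = (\<Sum>i\<in>{1..k}. a i)" by (simp add: sum_subtractf)
  finally show ?thesis .
qed

text \<open>On the \<open>i\<close>-th face the maximum is at least its \<open>i\<close>-th term.\<close>
lemma sum_face_moment_le_clustering_value:
  "(\<Sum>i\<in>{1..k}. face_moment (I i) (x i)) \<le> clustering_value M X k x"
proof -
  have "(\<Sum>i\<in>{1..k}. face_moment (I i) (x i)) \<le>
    (\<Sum>i\<in>{1..k}. \<integral>\<omega>. indicator (face_event (I i)) \<omega> * (MAX i\<in>{1..k}. (x i \<bullet> X \<omega>)\<^sup>2) \<partial>M)"
    unfolding face_moment_def
  proof (intro sum_mono integral_mono)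
    fix i \<omega> assume i: "i \<in> {1..k}"
    show "integrable M (\<lambda>\<omega>. indicator (face_event (I i)) \<omega> * (MAX i\<in>{1..k}. (x i \<bullet> X \<omega>)\<^sup>2))"
      using integrable_mult_indicator[OF face_event_sets Max_inner_sq_integrable] by simp
    have "(x i \<bullet> X \<omega>)\<^sup>2 \<le> (MAX i\<in>{1..k}. (x i \<bullet> X \<omega>)\<^sup>2)"
      using i by (intro Max_ge) auto
    then show "indicator (face_event (I i)) \<omega> * (x i \<bullet> X \<omega>)\<^sup>2
      \<le> indicator (face_event (I i)) \<omega> * (MAX i\<in>{1..k}. (x i \<bullet> X \<omega>)\<^sup>2)"
      by (simp split: split_indicator)
  qed simp
  also have "\<dots> = clustering_value M X k x"
    unfolding clustering_value_def
    by (rule integral_face_decomposition[symmetric, OF Max_inner_sq_integrable])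
  finally show ?thesis .
qed

text \<open>This is where the non-negativity of \<open>X\<close> enters: it makes the maximiser of the quadratic form
  non-negative, as in the Perron-Frobenius theorem.\<close>
lemma face_moment_abs_ge: "face_moment J v \<le> face_moment J (\<chi> j. \<bar>v $ j\<bar>)"
  unfolding face_moment_def
proof (intro integral_mono)
  fix \<omega> assume w: "\<omega> \<in> space M"
  have "\<bar>v \<bullet> X \<omega>\<bar> \<le> (\<Sum>j\<in>UNIV. \<bar>v $ j * X \<omega> $ j\<bar>)"
    unfolding inner_vec_def by (simp add: sum_abs)
  also have "\<dots> = (\<chi> j. \<bar>v $ j\<bar>) \<bullet> X \<omega>"
    using X_nonneg[OF w] by (simp add: inner_vec_def abs_mult)
  finally have "\<bar>v \<bullet> X \<omega>\<bar> \<le> \<bar>(\<chi> j. \<bar>v $ j\<bar>) \<bullet> X \<omega>\<bar>" by simp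
  then have "(v \<bullet> X \<omega>)\<^sup>2 \<le> ((\<chi> j. \<bar>v $ j\<bar>) \<bullet> X \<omega>)\<^sup>2"
    by (simp only: abs_le_square_iff)
  then show "indicator (face_event J) \<omega> * (v \<bullet> X \<omega>)\<^sup>2
      \<le> indicator (face_event J) \<omega> * ((\<chi> j. \<bar>v $ j\<bar>) \<bullet> X \<omega>)\<^sup>2"
    by (simp split: split_indicator)
qed simp_all

text \<open>The absolute values of the top eigenvectors of the blocks reach the upper bound, so they are optimal.\<close>
theorem optimal_centroids_in_faces:
  assumes p: "\<And>i. i \<in> {1..k} \<Longrightarrow> face_prob M X (I i) > 0"
    and gap: "\<And>i j. i \<in> {1..k} \<Longrightarrow> j \<in> {1..k} \<Longrightarrow>
      face_prob M X (I j) * nth_eigenvalue 2 (cross_moment M X (I j))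
      \<le> face_prob M X (I i) * nth_eigenvalue 1 (cross_moment M X (I i))"
  shows "\<exists>x. optimal_centroids M X k x \<and> (\<forall>i\<in>{1..k}. x i \<in> face (I i))"
proof -
  define a where "a i = face_prob M X (I i) * nth_eigenvalue 1 (cross_moment M X (I i))" for i
  define b where "b i = face_prob M X (I i) * nth_eigenvalue 2 (cross_moment M X (I i))" for i
  define c where "c = (MAX i\<in>{1..k}. b i)"
  note spec = face_moment_spectral[OF p I_nonempty, folded a_def b_def]
  have bc: "b i \<le> c" if "i \<in> {1..k}" for i
    using that unfolding c_def by (intro Max_ge) auto
  have c0: "0 \<le> c"
    using spec(2)[of 1] bc[of 1] k_pos by simp
  have ca: "c \<le> a i" if "i \<in> {1..k}" for i
    using gap[OF that] k_pos unfolding c_def a_def b_def by (subst Max_le_iff) auto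
  have "\<forall>i\<in>{1..k}. \<exists>v. v \<in> coordinate_subspace (I i) \<and> norm v = 1 \<and> face_moment (I i) v = a i \<and>
    (\<forall>y \<in> coordinate_subspace (I i). \<forall>t. v \<bullet> y = 0 \<longrightarrow>
       face_moment (I i) (t *\<^sub>R v + y) \<le> t\<^sup>2 * a i + b i * (y \<bullet> y))"
    using spec(1) by blast
  then obtain v where v: "\<forall>i\<in>{1..k}. v i \<in> coordinate_subspace (I i) \<and> norm (v i) = 1 \<and>
    face_moment (I i) (v i) = a i \<and>
    (\<forall>y \<in> coordinate_subspace (I i). \<forall>t. v i \<bullet> y = 0 \<longrightarrow>
       face_moment (I i) (t *\<^sub>R v i + y) \<le> t\<^sup>2 * a i + b i * (y \<bullet> y))"
    by (rule bchoice[THEN exE])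
  have mom: "(\<integral>\<omega>. (u \<bullet> X \<omega>)\<^sup>2 \<partial>M) \<le> c * (u \<bullet> u) + (\<Sum>i\<in>{1..k}. (a i - c) * (u \<bullet> v i)\<^sup>2)" for u
  proof (rule second_moment_le)
    fix i assume i: "i \<in> {1..k}"
    have "face_moment (I i) (t *\<^sub>R v i + y) \<le> t\<^sup>2 * a i + c * (y \<bullet> y)"
      if "y \<in> coordinate_subspace (I i)" "v i \<bullet> y = 0" for t y
    proof -
      have "face_moment (I i) (t *\<^sub>R v i + y) \<le> t\<^sup>2 * a i + b i * (y \<bullet> y)"
        using v i that by blast
      moreover have "b i * (y \<bullet> y) \<le> c * (y \<bullet> y)"
        using bc[OF i] by (intro mult_right_mono) auto
      ultimately show ?thesis by simp
    qed
    then show "v i \<in> coordinate_subspace (I i) \<and> norm (v i) = 1 \<and>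
      (\<forall>y \<in> coordinate_subspace (I i). \<forall>t. v i \<bullet> y = 0 \<longrightarrow>
         face_moment (I i) (t *\<^sub>R v i + y) \<le> t\<^sup>2 * a i + c * (y \<bullet> y))"
      using v i by blast
  qed
  define x where "x i = (\<chi> j. \<bar>v i $ j\<bar>)" for i
  have x_norm: "norm (x i) = norm (v i)" for i
    by (simp add: x_def norm_vec_def)
  have x: "x i \<in> face (I i)" "x i \<in> nonneg_sphere" if "i \<in> {1..k}" for i
    using v that x_norm[of i]
    by (auto simp: x_def face_def nonneg_sphere_def coordinate_subspace_def)
  have "(\<Sum>i\<in>{1..k}. a i) \<le> (\<Sum>i\<in>{1..k}. face_moment (I i) (x i))"
  proof (rule sum_mono)
    fix i assume "i \<in> {1..k}"
    then have "a i = face_moment (I i) (v i)" using v by simp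
    also have "\<dots> \<le> face_moment (I i) (x i)" unfolding x_def by (rule face_moment_abs_ge)
    finally show "a i \<le> face_moment (I i) (x i)" .
  qed
  also have "\<dots> \<le> clustering_value M X k x"
    by (rule sum_face_moment_le_clustering_value)
  finally have lower: "(\<Sum>i\<in>{1..k}. a i) \<le> clustering_value M X k x" .
  have upper: "clustering_value M X k y \<le> (\<Sum>i\<in>{1..k}. a i)"
    if "\<forall>i\<in>{1..k}. y i \<in> nonneg_sphere" for y
    using that v by (intro clustering_value_le[OF mom] c0 ca) (auto simp: nonneg_sphere_def)
  have "optimal_centroids M X k x"
    unfolding optimal_centroids_def is_arg_max_def
  proof (intro conjI ballI notI; (elim exE conjE)?)
    show "x i \<in> nonneg_sphere" if "i \<in> {1..k}" for i by (rule x(2)[OF that])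
    show False if "\<forall>i\<in>{1..k}. y i \<in> nonneg_sphere"
      "clustering_value M X k y > clustering_value M X k x" for y
      using upper[OF that(1)] lower that(2) by linarith
  qed
  with x(1) show ?thesis by blast
qed

text \<open>Off the face of its block, the coordinate \<open>X\<^sub>j\<close> is almost surely zero.\<close>
lemma integral_comp_face:
  assumes i: "i \<in> {1..k}" and j: "j \<in> I i"
  shows "(\<integral>\<omega>. indicator (face_event (I i)) \<omega> * X \<omega> $ j \<partial>M) = (\<integral>\<omega>. X \<omega> $ j \<partial>M)"
proof (rule integral_cong_AE)
  show "AE \<omega> in M. indicator (face_event (I i)) \<omega> * X \<omega> $ j = X \<omega> $ j"
    using AE_exists_face_event
  proof eventually_elim
    case (elim \<omega>)
    then obtain l where l: "l \<in> {1..k}" "\<omega> \<in> face_event (I l)" by blast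
    show ?case
    proof (cases "l = i")
      case True
      with l show ?thesis by simp
    next
      case False
      then have "I l \<inter> I i = {}"
        using I_disjoint i l unfolding disjoint_family_on_def by blast
      then have "j \<notin> I l" using j by blast
      then have "X \<omega> $ j = 0" using l by (simp add: face_event_def face_def)
      then show ?thesis by simp
    qed
  qed
qed auto

lemma face_prob_pos:
  assumes i: "i \<in> {1..k}" and mean: "\<And>j. (\<integral>\<omega>. X \<omega> $ j \<partial>M) = \<mu>" and "\<mu> > 0"
  shows "face_prob M X (I i) > 0"
proof (rule ccontr)
  assume "\<not> face_prob M X (I i) > 0"
  then have "prob (face_event (I i)) = 0"
    using measure_nonneg[of M "face_event (I i)"]
    unfolding face_prob_def face_event_def by linarith
  then have ae: "AE \<omega> in M. \<omega> \<notin> face_event (I i)"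
    by (simp add: prob_eq_0)
  obtain j where j: "j \<in> I i" using I_nonempty[OF i] by blast
  have "(\<integral>\<omega>. indicator (face_event (I i)) \<omega> * X \<omega> $ j \<partial>M) = 0"
    using ae by (intro integral_eq_zero_AE) auto
  with integral_comp_face[OF i j] mean \<open>\<mu> > 0\<close> show False by simp
qed

text \<open>The vector of ones on the block is the test vector. On the face the 1-norm of \<open>X\<close> is at least its 2-norm, which is one,
  so the linear form \<open>y \<bullet> X\<close> is at most its square.\<close>
lemma mean_le_top_eigenvalue:
  assumes i: "i \<in> {1..k}" and mean: "\<And>j. (\<integral>\<omega>. X \<omega> $ j \<partial>M) = \<mu>" and "\<mu> > 0"
  shows "\<mu> \<le> face_prob M X (I i) * nth_eigenvalue 1 (cross_moment M X (I i))" (is "_ \<le> ?a")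
proof -
  let ?J = "I i"
  let ?F = "indicator (face_event ?J) :: 'a \<Rightarrow> real"
  define y where "y = coordinate_proj ?J (\<chi> j. 1)"
  have fin: "0 < card ?J" using I_nonempty[OF i] by (simp add: card_gt_0_iff)
  have int: "integrable M (\<lambda>\<omega>. ?F \<omega> * X \<omega> $ j)" for j
    by (intro integrable_const_bound[of _ 1]) (auto split: split_indicator simp: X_nonneg X_le_1)
  have yX: "y \<bullet> x = (\<Sum>j\<in>?J. x $ j)" for x
  proof -
    have "y \<bullet> x = (\<Sum>j\<in>UNIV. if j \<in> ?J then x $ j else 0)"
      unfolding y_def inner_vec_def coordinate_proj_def by (intro sum.cong) auto
    then show ?thesis by (simp add: sum.If_cases)
  qed
  have "card ?J * \<mu> = (\<Sum>j\<in>?J. \<integral>\<omega>. ?F \<omega> * X \<omega> $ j \<partial>M)"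
    by (simp add: integral_comp_face[OF i] mean)
  also have "\<dots> = (\<integral>\<omega>. ?F \<omega> * (y \<bullet> X \<omega>) \<partial>M)"
    unfolding yX sum_distrib_left
    by (rule Bochner_Integration.integral_sum[symmetric]) (rule int)
  also have "\<dots> \<le> face_moment ?J y"
    unfolding face_moment_def
  proof (rule integral_mono)
    show "integrable M (\<lambda>\<omega>. ?F \<omega> * (y \<bullet> X \<omega>))"
      unfolding yX sum_distrib_left by (rule Bochner_Integration.integrable_sum) (rule int)
    fix \<omega> assume w: "\<omega> \<in> space M"
    show "?F \<omega> * (y \<bullet> X \<omega>) \<le> ?F \<omega> * (y \<bullet> X \<omega>)\<^sup>2"
    proof (cases "\<omega> \<in> face_event ?J")
      case True
      have "1 \<le> (\<Sum>j\<in>UNIV. \<bar>X \<omega> $ j\<bar>)"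
        using norm_le_l1_cart[of "X \<omega>"] X_norm[OF w] by simp
      also have "\<dots> = (\<Sum>j\<in>?J. X \<omega> $ j)"
        using True X_nonneg[OF w]
        by (intro sum.mono_neutral_cong_right) (auto simp: face_event_def face_def)
      finally have "1 \<le> y \<bullet> X \<omega>" by (simp add: yX)
      then have "y \<bullet> X \<omega> \<le> (y \<bullet> X \<omega>)\<^sup>2"
        by (simp add: self_le_power)
      then show ?thesis using True by simp
    qed simp
  qed simp
  also have "\<dots> \<le> ?a * (y \<bullet> y)"
    using face_moment_spectral(1)[OF face_prob_pos[OF i mean \<open>\<mu> > 0\<close>] I_nonempty[OF i]]
      coordinate_proj_in[of ?J] unfolding y_def by blast
  also have "y \<bullet> y = card ?J"
    by (simp add: yX) (simp add: y_def coordinate_proj_def)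
  finally show ?thesis using fin by (simp add: mult.commute)
qed

end

theorem theorem5p2:
  fixes M :: "'a measure"
    and X :: "'a \<Rightarrow> real ^ 'n::{finite, linorder}"
    and k :: nat
    and I :: "nat \<Rightarrow> 'n set"
  assumes "prob_space M"
    and "X \<in> borel_measurable M"
    and "\<And>\<omega>. \<omega> \<in> space M \<Longrightarrow> X \<omega> \<in> nonneg_sphere"
    and "2 \<le> k" and "k \<le> CARD('n)"
    and "\<And>i. i \<in> {1..k} \<Longrightarrow> I i \<noteq> {}"
    and "disjoint_family_on I {1..k}"
    and "(\<Union>i\<in>{1..k}. I i) = UNIV"
    and "\<P>(\<omega> in M. X \<omega> \<in> (\<Union>i\<in>{1..k}. face (I i))) = 1"
  shows "((\<forall>i\<in>{1..k}. face_prob M X (I i) > 0) \<and>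
          (MIN i\<in>{1..k}. face_prob M X (I i) * nth_eigenvalue 1 (cross_moment M X (I i)))
            \<ge> (MAX i\<in>{1..k}. face_prob M X (I i) * nth_eigenvalue 2 (cross_moment M X (I i)))
          \<longrightarrow> (\<exists>x. optimal_centroids M X k x \<and> (\<forall>i\<in>{1..k}. x i \<in> face (I i))))
       \<and> (\<forall>\<mu>::real. \<mu> > 0 \<and> (\<forall>j. (\<integral>\<omega>. X \<omega> $ j \<partial>M) = \<mu>) \<and>
            (\<forall>i\<in>{1..k}. nth_eigenvalue 2 (cross_moment M X (I i)) \<le> \<mu> / face_prob M X (I i))
          \<longrightarrow> (MIN i\<in>{1..k}. face_prob M X (I i) * nth_eigenvalue 1 (cross_moment M X (I i)))
            \<ge> (MAX i\<in>{1..k}. face_prob M X (I i) * nth_eigenvalue 2 (cross_moment M X (I i))))"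
proof -
  let ?a = "\<lambda>i. face_prob M X (I i) * nth_eigenvalue 1 (cross_moment M X (I i))"
  let ?b = "\<lambda>i. face_prob M X (I i) * nth_eigenvalue 2 (cross_moment M X (I i))"
  interpret prob_space M by fact
  interpret face_partitioned_vector M X k I
    using assms by unfold_locales auto
  have K: "{1..k} \<noteq> {}" using \<open>2 \<le> k\<close> by simp
  have minmax: "(MAX i\<in>{1..k}. ?b i) \<le> (MIN i\<in>{1..k}. ?a i)
      \<longleftrightarrow> (\<forall>i\<in>{1..k}. \<forall>j\<in>{1..k}. ?b j \<le> ?a i)"
    using K by (auto simp: Max_le_iff Min_ge_iff)
  show ?thesis
  proof (intro conjI allI impI)
    assume *: "(\<forall>i\<in>{1..k}. face_prob M X (I i) > 0) \<and> (MIN i\<in>{1..k}. ?a i) \<ge> (MAX i\<in>{1..k}. ?b i)"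
    show "\<exists>x. optimal_centroids M X k x \<and> (\<forall>i\<in>{1..k}. x i \<in> face (I i))"
      using * unfolding minmax by (intro optimal_centroids_in_faces) auto
  next
    fix \<mu> :: real
    assume *: "\<mu> > 0 \<and> (\<forall>j. (\<integral>\<omega>. X \<omega> $ j \<partial>M) = \<mu>) \<and>
      (\<forall>i\<in>{1..k}. nth_eigenvalue 2 (cross_moment M X (I i)) \<le> \<mu> / face_prob M X (I i))"
    have "?b j \<le> \<mu>" if "j \<in> {1..k}" for j
    proof -
      have "face_prob M X (I j) > 0" using * face_prob_pos[OF that, of \<mu>] by blast
      moreover have "nth_eigenvalue 2 (cross_moment M X (I j)) \<le> \<mu> / face_prob M X (I j)"
        using * that by blast
      ultimately show ?thesis by (simp add: pos_le_divide_eq mult.commute)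
    qed
    moreover have "\<mu> \<le> ?a i" if "i \<in> {1..k}" for i
      using * mean_le_top_eigenvalue[OF that, of \<mu>] by simp
    ultimately show "(MIN i\<in>{1..k}. ?a i) \<ge> (MAX i\<in>{1..k}. ?b i)"
      unfolding minmax by (meson order_trans)
  qed
qed

end
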